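(* Let $k$ be a positive integer such that $p = 2^k - 1$ is a prime number, and let $n = 2^{k-1}\cdot(2^k - 1)$ (a perfect number). Then $S(n) = p$.
   Context: For a positive integer $n$, Smarandache's function $S(n)$ is defined as the smallest positive integer $m$ such that $m!$ is divisible by $n$. *)

theory Defs
  imports Complex_Main "HOL-Computational_Algebra.Primes"
begin

(* Meaningful for n > 0 only: no factorial is divisible by 0. *)
definition smarandache :: "nat \<Rightarrow> nat" where
  "smarandache n = (LEAST m. 0 < m \<and> n dvd fact m)"

end

theory Submission
  imports Defs
begin

text \<open>A prime \<open>p\<close> divides \<open>fact m\<close> only if \<open>p \<le> m\<close>;
  since \<open>p\<close> divides \<open>n\<close>, no \<open>m\<close> below \<open>p\<close> works.
  Conversely, \<open>p\<close> and \<open>2 ^ (k - 1) \<le> p\<close> each occur among the factors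
  of \<open>fact p\<close>, and they are coprime because \<open>p\<close> is odd, so their product
  \<open>n\<close> divides \<open>fact p\<close>.\<close>

theorem mainTheorem1:
  fixes k p n :: nat
  assumes "0 < k"
    and "p = 2 ^ k - 1"
    and "prime p"
    and "n = 2 ^ (k - 1) * (2 ^ k - 1)"
  shows "smarandache n = p"
proof -
  have n: "n = 2 ^ (k - 1) * p"
    using assms by simp
  \<comment> \<open>Fails at \<open>k = 0\<close>, where \<open>k - 1\<close> truncates. The
    resulting form of \<open>p\<close> gives both its oddness and the bound
    \<open>2 ^ (k - 1) \<le> p\<close>.\<close>
  have "2 ^ k = 2 * (2::nat) ^ (k - 1)"
    using \<open>0 < k\<close> by (cases k) auto
  then have p: "p = 2 * 2 ^ (k - 1) - 1"
    using assms(2) by simp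
  have pow_pos: "(1::nat) \<le> 2 ^ (k - 1)"
    by simp
  have "odd p"
    unfolding p by simp
  then have "coprime (2 ^ (k - 1)) p"
    by simp
  moreover have "2 ^ (k - 1) dvd (fact p :: nat)"
  proof (rule dvd_fact)
    show "2 ^ (k - 1) \<le> p"
      using p pow_pos by linarith
  qed (rule pow_pos)
  moreover have "p dvd fact p"
    using \<open>prime p\<close> by (simp add: prime_dvd_fact_iff)
  ultimately have "n dvd fact p"
    unfolding n by (simp add: divides_mult)
  \<comment> \<open>Minimality: only the prime factor \<open>p\<close> of \<open>n\<close> matters
    here.\<close>
  moreover have "p \<le> m" if "n dvd fact m" for m
  proof -
    have "p dvd fact m"
      using that unfolding n by (rule dvd_mult_right)
    then show ?thesis
      using \<open>prime p\<close> by (simp add: prime_dvd_fact_iff)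
  qed
  ultimately show ?thesis
    unfolding smarandache_def
    using prime_gt_0_nat[OF \<open>prime p\<close>] by (intro Least_equality) auto
qed

end
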